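(* Let $f(z)=z^2+i$, so $P_f=\{i,\,i-1,\,-i,\,\infty\}$. For every $\gamma\in\mathcal{C}(\widehat{\mathbb{C}},P_f)$ there exists $n\ge1$ such that every component of $f^{-n}(\gamma)$ is trivial (inessential or peripheral) in $\widehat{\mathbb{C}}-P_f$.
   Context: For a finite set $P\subset\widehat{\mathbb{C}}$ with $\#P\ge3$, $\mathcal{C}(\widehat{\mathbb{C}},P)$ is the set of free homotopy classes in $\widehat{\mathbb{C}}-P$ of unoriented simple closed curves which are essential and nonperipheral (not homotopic to a point nor into arbitrarily small neighborhoods of a point of $P$); the other simple closed curves in $\widehat{\mathbb{C}}-P$ are called trivial. $P_f$ denotes the postcritical set of $f$ (here the forward orbit of the critical value $i$ together with $\infty$). *)

theory Defs
  imports "HOL-Analysis.Analysis"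
begin

definition fmap :: "complex \<Rightarrow> complex" where
  "fmap z = z ^ 2 + \<i>"

text \<open>Finite part of the postcritical set P_f = {i, i-1, -i, infinity};
  infinity is handled separately (the sphere minus P_f is the plane minus Pfin).\<close>
definition Pfin :: "complex set" where
  "Pfin = {\<i>, \<i> - 1, -\<i>}"

definition Sf :: "complex set" where
  "Sf = - Pfin"

definition simple_closed_curve_in :: "complex set \<Rightarrow> (real \<Rightarrow> complex) \<Rightarrow> bool" where
  "simple_closed_curve_in S c \<longleftrightarrow>
     simple_path c \<and> pathfinish c = pathstart c \<and> path_image c \<subseteq> S"

definition inessential_in :: "complex set \<Rightarrow> (real \<Rightarrow> complex) \<Rightarrow> bool" where
  "inessential_in S c \<longleftrightarrow> (\<exists>a\<in>S. homotopic_loops S c (\<lambda>t. a))"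

definition peripheral_at :: "complex set \<Rightarrow> complex \<Rightarrow> (real \<Rightarrow> complex) \<Rightarrow> bool" where
  "peripheral_at S p c \<longleftrightarrow>
     (\<forall>e>0. \<exists>d. homotopic_loops S c d \<and> path_image d \<subseteq> ball p e)"

definition peripheral_at_infinity :: "complex set \<Rightarrow> (real \<Rightarrow> complex) \<Rightarrow> bool" where
  "peripheral_at_infinity S c \<longleftrightarrow>
     (\<forall>R. \<exists>d. homotopic_loops S c d \<and> path_image d \<subseteq> {z. R < norm z})"

definition trivial_curve :: "complex set \<Rightarrow> (real \<Rightarrow> complex) \<Rightarrow> bool" where
  "trivial_curve P c \<longleftrightarrow>
     inessential_in (- P) c \<or> (\<exists>p\<in>P. peripheral_at (- P) p c) \<or>
     peripheral_at_infinity (- P) c"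

end

theory Submission
  imports Defs "HOL-Complex_Analysis.Complex_Analysis"
begin

text \<open>
  A simple closed curve is trivial unless it encloses exactly two of the three finite postcritical
  points. Along \<open>\<i> \<mapsto> \<i> - 1 \<leftrightarrow> -\<i>\<close>, a curve enclosing \<open>{\<i>, \<i> - 1}\<close> pulls back to one
  enclosing \<open>{\<i>, -\<i>}\<close>, whose pullback encloses only \<open>\<i> - 1\<close>. A curve enclosing
  \<open>{\<i> - 1, -\<i>}\<close> has two pullbacks, both of degree one, and at most one of them is nontrivial; it
  encloses \<open>\<i> - 1\<close> and one of \<open>\<i>, -\<i>\<close>. So a curve can only stay nontrivial for long if it keeps
  enclosing the repelling cycle \<open>{\<i> - 1, -\<i>}\<close>. Then the iterates have univalent inverse branches
  on the interior of the original curve. These are uniformly bounded and permute the cycle, while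
  their derivatives at \<open>\<i> - 1\<close> tend to 0. By Montel and Hurwitz a limit is univalent with a
  vanishing derivative, which is absurd.
\<close>

subsection \<open>Trivial curves\<close>

text \<open>A connected set that avoids \<open>S\<close> cannot cross \<open>frontier V\<close>, so
  it stays in \<open>V\<close> once it meets \<open>V\<close>. Applied to the components of
  \<open>-S\<close> and then to \<open>inside S\<close>, this gives the two inclusions.\<close>

lemma inside_eqI:
  fixes S V :: "'a::{real_normed_vector,perfect_space} set"
  assumes "connected (inside S)" "bounded V" "V \<noteq> {}" "V \<inter> S = {}" "frontier V \<subseteq> S"
  shows "inside S = V"
proof
  show sub: "V \<subseteq> inside S"
  proof
    fix x assume x: "x \<in> V"
    let ?Y = "connected_component_set (-S) x"
    have "x \<in> ?Y" using x assms(4) by auto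
    moreover have "?Y \<inter> S = {}" using connected_component_subset by fastforce
    ultimately have "?Y \<subseteq> V"
      using connected_Int_frontier[of ?Y V] assms(5) x connected_connected_component[of "-S" x] by blast
    then show "x \<in> inside S"
      using x assms bounded_subset by (auto simp: inside_def)
  qed
  show "inside S \<subseteq> V"
    using connected_Int_frontier[of "inside S" V] assms sub inside_no_overlap[of S] by blast
qed

lemma finite_subset_compact_connected:
  fixes S :: "'a::real_normed_vector set"
  assumes "open S" "connected S" "finite F" "F \<subseteq> S" "a \<in> S"
  obtains T where "compact T" "connected T" "F \<subseteq> T" "a \<in> T" "T \<subseteq> S"
proof -
  have "path_connected S" using assms connected_open_path_connected by blast
  then have "\<exists>g. path g \<and> path_image g \<subseteq> S \<and> pathstart g = a \<and> pathfinish g = q" if "q \<in> F" for q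
    using that assms unfolding path_connected_def by blast
  then obtain g where g: "\<And>q. q \<in> F \<Longrightarrow> path (g q) \<and> path_image (g q) \<subseteq> S \<and> pathstart (g q) = a \<and> pathfinish (g q) = q"
    by metis
  have a_in: "a \<in> path_image (g q)" "q \<in> path_image (g q)" if "q \<in> F" for q
    using g[OF that] by (metis pathstart_in_path_image, metis pathfinish_in_path_image)
  define T where "T = {a} \<union> (\<Union>q\<in>F. path_image (g q))"
  show thesis
  proof
    show "compact T" unfolding T_def using assms g by (intro compact_Un compact_UN) auto
    have T_eq: "T = \<Union> (insert {a} ((\<lambda>q. path_image (g q)) ` F))" by (auto simp: T_def)
    show "connected T" unfolding T_eq
      by (rule connected_Union) (use g a_in in \<open>auto intro: connected_path_image\<close>)
    show "T \<subseteq> S" unfolding T_def using g assms by blast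
  qed (use a_in in \<open>auto simp: T_def\<close>)
qed

text \<open>A compact connected set ties \<open>F\<close> to the outside of a large disc without
  touching the curve. Removing both leaves the curve in a bounded open component whose complement is
  connected, and such a component is simply connected.\<close>

lemma simply_connected_neighbourhood:
  fixes c :: "real \<Rightarrow> complex"
  assumes c: "simple_path c" "pathfinish c = pathstart c" and F: "finite F" "F \<subseteq> outside (path_image c)"
  obtains U where "open U" "bounded U" "simply_connected U" "path_image c \<subseteq> U" "U \<inter> F = {}"
proof -
  note J = Jordan_inside_outside[OF c]
  let ?O = "outside (path_image c)"
  have "bounded (path_image c \<union> inside (path_image c))"
    using J by (simp add: bounded_path_image c simple_path_imp_path)
  then obtain R where R: "R > 0" "path_image c \<union> inside (path_image c) \<subseteq> ball 0 R"
    by (metis bounded_subset_ballD)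
  have out: "- ball 0 R \<subseteq> ?O"
    using R by (auto simp: outside_inside)
  have aO: "complex_of_real R \<in> ?O" using out R by auto
  obtain T where T: "compact T" "connected T" "F \<subseteq> T" "complex_of_real R \<in> T" "T \<subseteq> ?O"
    using finite_subset_compact_connected[of ?O F "of_real R"] J F aO by blast
  define K where "K = T \<union> - ball 0 R"
  have "connected (- ball (0::complex) R)"
    by (rule connected_complement_bounded_convex) auto
  \<comment> \<open>\<open>T\<close> contains the point \<open>R\<close> of the bounding circle,
    which also lies in \<open>- ball 0 R\<close>, so the two connected pieces overlap.\<close>
  then have conK: "connected K"
    unfolding K_def using T R by (intro connected_Un) auto
  have "closed K" unfolding K_def using T by (auto intro: compact_imp_closed)
  have KO: "K \<subseteq> ?O" using T out by (auto simp: K_def)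
  then have cK: "path_image c \<subseteq> - K" by (auto simp: outside_inside)
  define U where "U = connected_component_set (-K) (pathstart c)"
  have s: "pathstart c \<in> path_image c" by blast
  have Uc: "U \<in> components (-K)" unfolding U_def components_def using s cK by auto
  have cU: "path_image c \<subseteq> U" unfolding U_def
    using s cK by (intro connected_component_maximal) (auto simp: c connected_simple_path_image)
  have "U \<subseteq> - K" using Uc in_components_subset by blast
  have "open U" using Uc \<open>closed K\<close> open_components by blast
  moreover have "bounded U" using \<open>U \<subseteq> - K\<close> by (auto simp: K_def intro: bounded_subset[OF bounded_ball[of 0 R]])
  moreover have "simply_connected U"
    using simply_connected_iff_simple \<open>open U\<close> \<open>bounded U\<close> component_complement_connected[OF conK Uc]
       in_components_connected[OF Uc] by blast
  moreover have "U \<inter> F = {}" using \<open>U \<subseteq> - K\<close> T by (auto simp: K_def)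
  ultimately show thesis using that cU by blast
qed

text \<open>Contract radially in the Riemann coordinate of \<open>U\<close>.\<close>
lemma homotopic_loops_towards_point:
  fixes c :: "real \<Rightarrow> complex"
  assumes U: "open U" "bounded U" "simply_connected U"
    and c: "path c" "pathfinish c = pathstart c" "path_image c \<subseteq> U - {p}" and "p \<in> U" "e > 0"
  obtains d where "homotopic_loops (U - {p}) c d" "path_image d \<subseteq> ball p e"
proof -
  have "U \<noteq> UNIV" using U by auto
  then obtain f g where fg: "f holomorphic_on U" "g holomorphic_on ball 0 1"
     "\<And>z. z \<in> U \<Longrightarrow> f z \<in> ball 0 1 \<and> g (f z) = z" "\<And>z. z \<in> ball 0 1 \<Longrightarrow> g z \<in> U \<and> f (g z) = z"
    using Riemann_mapping_theorem[of U] U \<open>p \<in> U\<close> by blast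
  define q where "q = f p"
  have q: "q \<in> ball 0 1" "g q = p" using fg \<open>p \<in> U\<close> by (auto simp: q_def)
  have cont: "continuous_on U f" "continuous_on (ball 0 1) g"
    using fg holomorphic_on_imp_continuous_on by blast+
  have "\<exists>\<delta>>0. \<forall>w\<in>ball 0 1. dist w q < \<delta> \<longrightarrow> dist (g w) p < e"
    using cont(2) q \<open>e > 0\<close> unfolding continuous_on_iff by metis
  then obtain \<delta> where \<delta>: "\<delta> > 0" "\<And>w. w \<in> ball 0 1 \<Longrightarrow> dist w q < \<delta> \<Longrightarrow> dist (g w) p < e"
    by blast
  \<comment> \<open>Points of the unit disc are at most 2 apart, so contracting towards
    \<open>q\<close> by a factor \<open>s\<close> with \<open>2 * s < \<delta>\<close> lands in the
    \<open>\<delta>\<close>-ball; this choice also gives \<open>s < 1\<close>.\<close>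
  define s where "s = \<delta> / (2 + \<delta>)"
  have s: "0 < s" "s < 1" "2 * s < \<delta>" using \<delta>(1) by (auto simp: s_def field_simps)
  define d where "d = (\<lambda>t. q + of_real s * (f (c t) - q))"
  have ct: "c t \<in> U" "c t \<noteq> p" if "t \<in> {0..1}" for t
    using that c(3) by (auto simp: path_image_def image_subset_iff)
  have A: "f (c t) \<in> ball 0 1" "f (c t) \<noteq> q" if "t \<in> {0..1}" for t
    using ct[OF that] fg(3)[of "c t"] q by auto
  have pf: "path (f \<circ> c)" using c cont by (intro path_continuous_image) (auto intro: continuous_on_subset)
  have d_comb: "d t = (1 - s) *\<^sub>R q + s *\<^sub>R f (c t)" for t
    by (simp add: d_def scaleR_conv_of_real algebra_simps)
  have d_ball: "d t \<in> ball 0 1" if "t \<in> {0..1}" for t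
    unfolding d_comb using A[OF that] q s by (intro convexD) auto
  have H: "homotopic_loops (ball 0 1 - {q}) (f \<circ> c) d"
  proof (rule homotopic_loops_linear)
    show "path d" using pf unfolding d_def path_def comp_def by (intro continuous_intros)
    show "pathfinish d = pathstart d" using c by (simp add: d_def path_defs)
    show "pathfinish (f \<circ> c) = pathstart (f \<circ> c)" using c by (simp add: path_defs)
    fix t :: real assume t: "t \<in> {0..1}"
    show "closed_segment ((f \<circ> c) t) (d t) \<subseteq> ball 0 1 - {q}"
    proof -
      have "closed_segment ((f \<circ> c) t) (d t) \<subseteq> ball 0 1"
        using A[OF t] d_ball[OF t] by (intro closed_segment_subset) auto
      moreover have "q \<notin> closed_segment ((f \<circ> c) t) (d t)"
      proof
        assume "q \<in> closed_segment ((f \<circ> c) t) (d t)"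
        then obtain u where u: "0 \<le> u" "u \<le> 1" "q = (1 - u) *\<^sub>R f (c t) + u *\<^sub>R d t"
          by (auto simp: closed_segment_def)
        \<comment> \<open>A point of the segment differs from \<open>q\<close> by
          \<open>1 - u + u * s\<close> times \<open>f (c t) - q\<close>. This factor is positive, so
          the contraction never passes through \<open>q\<close>.\<close>
        then have "of_real (1 - u + u * s) * (f (c t) - q) = 0"
          by (simp add: d_def scaleR_conv_of_real algebra_simps)
        then have "1 - u + u * s = 0" using A(2)[OF t] by (metis mult_eq_0_iff of_real_eq_0_iff right_minus_eq)
        moreover have "u = 1 \<or> 1 - u > 0" "u * s \<ge> 0" using u s by auto
        ultimately show False using s by auto
      qed
      ultimately show ?thesis by blast
    qed
  qed (use pf in auto)
  have "homotopic_loops (U - {p}) (g \<circ> (f \<circ> c)) (g \<circ> d)"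
  proof (rule homotopic_loops_continuous_image[OF H])
    show "continuous_on (ball 0 1 - {q}) g" using cont by (rule_tac continuous_on_subset) auto
    show "g \<in> ball 0 1 - {q} \<rightarrow> U - {p}" using fg(4) q by (auto simp: q_def)
  qed
  moreover have "homotopic_loops (U - {p}) c (g \<circ> (f \<circ> c))"
    using ct fg(3) by (intro homotopic_loops_eq) (auto simp: c)
  ultimately have "homotopic_loops (U - {p}) c (g \<circ> d)" by (rule homotopic_loops_trans[rotated])
  moreover have "path_image (g \<circ> d) \<subseteq> ball p e"
  proof -
    have "dist (d t) q < \<delta>" if "t \<in> {0..1}" for t
    proof -
      have "dist (d t) q = s * norm (f (c t) - q)"
        using s by (simp add: d_def dist_norm norm_mult)
      also have "norm (f (c t) - q) \<le> 2"
        using A(1)[OF that] q norm_triangle_ineq4[of "f (c t)" q] by auto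
      then have "s * norm (f (c t) - q) \<le> s * 2" using s by simp
      finally show ?thesis using s by simp
    qed
    then show ?thesis using \<delta>(2) d_ball by (force simp: path_image_def dist_commute)
  qed
  ultimately show thesis by (rule that)
qed

section \<open>Curves with at most one puncture on one side\<close>

text \<open>The points of \<open>P\<close> other than \<open>p\<close> lie outside the curve, so a
  simply connected neighbourhood of the curve can avoid them. It contains the interior, and
  shrinking towards \<open>p\<close> within it never meets \<open>P\<close>.\<close>

lemma peripheral_at_if_inside:
  assumes c: "simple_closed_curve_in (-P) c" and P: "finite P" and p: "p \<in> inside (path_image c)"
    and "inside (path_image c) \<inter> P \<subseteq> {p}"
  shows "peripheral_at (-P) p c"
  unfolding peripheral_at_def
proof (intro allI impI)
  fix e :: real assume "e > 0"
  have c': "simple_path c" "pathfinish c = pathstart c" "path_image c \<inter> P = {}"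
    using c by (auto simp: simple_closed_curve_in_def)
  have out: "P - {p} \<subseteq> outside (path_image c)"
    using assms(4) c' by (auto simp: outside_inside)
  obtain U where U: "open U" "bounded U" "simply_connected U" "path_image c \<subseteq> U" "U \<inter> (P - {p}) = {}"
    using simply_connected_neighbourhood[OF c'(1,2) _ out] P by blast
  have pU: "p \<in> U" using subset_simply_connected_imp_inside_subset U p by blast
  have "p \<notin> path_image c" using p inside_no_overlap by blast
  then obtain d where d: "homotopic_loops (U - {p}) c d" "path_image d \<subseteq> ball p e"
    using homotopic_loops_towards_point[of U c p e] U c' pU \<open>e > 0\<close> simple_path_imp_path by blast
  moreover have "U - {p} \<subseteq> - P" using U by auto
  ultimately show "\<exists>d. homotopic_loops (- P) c d \<and> path_image d \<subseteq> ball p e"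
    using homotopic_loops_subset by blast
qed

text \<open>Here the simply connected neighbourhood avoids all of \<open>P\<close>, so the curve
  contracts within it.\<close>

lemma inessential_if_inside:
  assumes c: "simple_closed_curve_in (-P) c" and P: "finite P"
    and "inside (path_image c) \<inter> P = {}"
  shows "inessential_in (-P) c"
proof -
  have c': "simple_path c" "pathfinish c = pathstart c" "path_image c \<inter> P = {}"
    using c by (auto simp: simple_closed_curve_in_def)
  have out: "P \<subseteq> outside (path_image c)"
    using assms(3) c' by (auto simp: outside_inside)
  obtain U where U: "open U" "bounded U" "simply_connected U" "path_image c \<subseteq> U" "U \<inter> P = {}"
    using simply_connected_neighbourhood[OF c'(1,2) P out] by blast
  define a where "a = pathstart c"
  have a: "a \<in> U" using U a_def by blast
  have "homotopic_loops U c (linepath a a)"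
    using U c' a simple_path_imp_path simply_connected_eq_contractible_loop_any by blast
  moreover have "U \<subseteq> - P" using U by auto
  ultimately show ?thesis
    unfolding inessential_in_def using a homotopic_loops_subset[of U c "linepath a a"]
    by (auto simp: linepath_refl)
qed

text \<open>The inversion at an interior point \<open>a\<close> reduces this to a curve around 0. Since \<open>inverse 0 = 0\<close>,
  the map \<open>I\<close> below is a bijection of the plane, but \<open>I a = 0\<close> is a junk value; hence
  the case distinctions at \<open>a\<close>.\<close>
lemma peripheral_at_infinity_if_inside:
  assumes c: "simple_closed_curve_in (-P) c" and P: "finite P" "P \<subseteq> inside (path_image c)"
  shows "peripheral_at_infinity (-P) c"
proof -
  have c': "simple_path c" "pathfinish c = pathstart c" "path_image c \<inter> P = {}"
    using c by (auto simp: simple_closed_curve_in_def)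
  note J = Jordan_inside_outside[OF c'(1,2)]
  obtain a where a: "a \<in> inside (path_image c)" using J by blast
  obtain \<rho> where \<rho>: "\<rho> > 0" "ball a \<rho> \<subseteq> inside (path_image c)"
    using J a openE by blast
  define I where "I = (\<lambda>z. inverse (z - a))"
  have injI: "I x = I y \<longleftrightarrow> x = y" for x y by (auto simp: I_def)
  have contI: "continuous_on S I" if "a \<notin> S" for S
    unfolding I_def using that by (intro continuous_intros) auto
  have ac: "a \<notin> path_image c" using a inside_no_overlap by blast
  define e where "e = I \<circ> c"
  have im_e: "path_image e = I ` path_image c" by (simp add: e_def path_image_compose)
  have "simple_path e"
    unfolding e_def using c' contI[OF ac] injI
    by (intro simple_path_continuous_image) (auto simp: inj_on_def)
  moreover have "pathfinish e = pathstart e"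
    using c'(2) by (simp add: e_def path_defs)
  ultimately have e: "simple_path e" "pathfinish e = pathstart e" by blast+
  note Je = Jordan_inside_outside[OF e]
  \<comment> \<open>\<open>0\<close> is the image of infinity, hence a puncture for
    \<open>e\<close>.\<close>
  define Q where "Q = insert 0 (I ` P)"
  define W where "W = I ` (inside (path_image c) - {a})"
  have conW: "connected W" unfolding W_def
    using J by (intro connected_continuous_image contI connected_open_delete) auto
  have We: "W \<subseteq> - path_image e" using inside_no_overlap[of "path_image c"] unfolding W_def im_e
      by (auto simp del: inside_no_overlap simp: injI disjoint_iff)
  \<comment> \<open>Points near \<open>a\<close> are sent far away. Being connected, unbounded and
    disjoint from \<open>e\<close>, \<open>W\<close> must then lie in the outside of
    \<open>e\<close>.\<close>
  have "\<not> bounded W"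
  proof
    assume "bounded W"
    then obtain B where B: "B > 0" "\<And>w. w \<in> W \<Longrightarrow> norm w \<le> B" using bounded_pos by metis
    define s where "s = min (\<rho>/2) (1 / (B+1))"
    have s: "s > 0" "s < \<rho>" "s \<le> 1 / (B+1)" using B \<rho>(1) by (auto simp: s_def min_def)
    have "I (a + of_real s) \<in> W" unfolding W_def using s \<rho> by (intro imageI) (auto simp: dist_norm)
    from B(2)[OF this] have "1 / s \<le> B" using s by (simp add: I_def inverse_eq_divide norm_divide)
    moreover have "1 / s \<ge> B + 1" using s B by (simp add: field_simps)
    ultimately show False by simp
  qed
  have Wout: "W \<subseteq> outside (path_image e)"
  proof
    fix w assume "w \<in> W"
    then have "W \<subseteq> connected_component_set (- path_image e) w"
      using conW We by (intro connected_component_maximal)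
    then show "w \<in> outside (path_image e)"
      using We \<open>w \<in> W\<close> \<open>\<not> bounded W\<close> bounded_subset by (auto simp: outside)
  qed
  have ball0: "\<exists>z \<in> outside (path_image c). I z \<in> ball 0 r" if "r > 0" for r
  proof -
    obtain z where z: "z \<in> outside (path_image c)" "norm z > norm a + 1 / r"
      using J unfolding bounded_iff by (meson not_le)
    then have "norm (z - a) > 1 / r" using norm_triangle_sub[of z a] by simp
    moreover have "z \<noteq> a" using calculation that by (auto simp: not_less)
    moreover have "norm (I z) = 1 / norm (z - a)" by (simp add: I_def inverse_eq_divide norm_divide)
    ultimately have "norm (I z) < r" using that by (simp add: divide_less_eq mult.commute)
    then show ?thesis using z by auto
  qed
  have surjI: "\<exists>z. w = I z" for w by (intro exI[of _ "a + inverse w"]) (auto simp: I_def)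
  \<comment> \<open>The image of the exterior is connected and misses \<open>e\<close>, so one of
    its points inside \<open>e\<close> suffices. A nonzero point inside \<open>e\<close> comes
    neither from \<open>c\<close> nor from the punctured interior, whose image \<open>W\<close> is
    outside, so it comes from the exterior.\<close>
  have Vin: "I ` outside (path_image c) \<subseteq> inside (path_image e)"
  proof -
    have con: "connected (I ` outside (path_image c))"
      using J a by (intro connected_continuous_image contI) blast+
    have dis: "I ` outside (path_image c) \<inter> path_image e = {}"
      using outside_no_overlap[of "path_image c"] unfolding im_e
      by (auto simp del: outside_no_overlap simp: injI disjoint_iff)
    have "infinite (inside (path_image e))"
      using Je by (meson finite_imp_not_open)
    then obtain w where w: "w \<in> inside (path_image e)" "w \<noteq> 0"
      by (metis finite.simps finite_subset insertCI subsetI)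
    obtain z where z: "w = I z" using surjI by blast
    have "z \<in> outside (path_image c)"
    proof (rule ccontr)
      assume "z \<notin> outside (path_image c)"
      then have "z \<in> path_image c \<or> z \<in> inside (path_image c) - {a}"
        using w z by (auto simp: outside_inside I_def)
      then have "w \<in> path_image e \<or> w \<in> W" unfolding z im_e W_def by blast
      then show False using w Wout Je inside_no_overlap[of "path_image e"] by blast
    qed
    then have ne: "inside (path_image e) \<inter> I ` outside (path_image c) \<noteq> {}" using w z by blast
    show ?thesis
      using connected_Int_frontier[OF con, of "inside (path_image e)"] Je ne dis by blast
  qed
  \<comment> \<open>Far exterior points are sent arbitrarily close to \<open>0\<close> and land
    inside \<open>e\<close>, so \<open>0\<close> cannot belong to the open outside.\<close>
  have in0: "0 \<in> inside (path_image e)"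
  proof (rule ccontr)
    assume n: "0 \<notin> inside (path_image e)"
    have "0 \<notin> path_image e" unfolding im_e using ac by (auto simp: I_def)
    then have "0 \<in> outside (path_image e)" using n by (auto simp: outside_inside)
    then obtain r where r: "r > 0" "ball 0 r \<subseteq> outside (path_image e)" using Je openE by blast
    obtain z where "z \<in> outside (path_image c)" "I z \<in> ball 0 r" using ball0[OF r(1)] by blast
    then have "I z \<in> inside (path_image e) \<inter> outside (path_image e)" using r(2) Vin by blast
    then show False by simp
  qed
  have eQ: "path_image e \<inter> Q = {}" unfolding im_e Q_def using c' ac injI by (auto simp: I_def)
  have "peripheral_at (-Q) 0 e"
  proof (rule peripheral_at_if_inside)
    show "simple_closed_curve_in (-Q) e" using e eQ by (auto simp: simple_closed_curve_in_def)
    show "finite Q" using P by (simp add: Q_def)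
    have "I ` P \<subseteq> W \<union> {0}" using P by (auto simp: W_def I_def)
    moreover have "inside (path_image e) \<inter> W = {}" using Wout inside_Int_outside[of "path_image e"] by blast
    ultimately show "inside (path_image e) \<inter> Q \<subseteq> {0}" by (auto simp: Q_def)
  qed (rule in0)
  show ?thesis unfolding peripheral_at_infinity_def
  proof
    fix R :: real
    \<comment> \<open>For nonzero \<open>w\<close> with \<open>norm w < r\<close> the inverse has
      norm above \<open>\<bar>R\<bar> + norm a + 1\<close>, which leaves more than \<open>R\<close>
      after translating by \<open>a\<close>.\<close>
    define r where "r = 1 / (\<bar>R\<bar> + norm a + 1)"
    have r: "r > 0" "1 / r = \<bar>R\<bar> + norm a + 1"
      by (auto simp: r_def intro!: add_nonneg_pos)
    obtain d where d: "homotopic_loops (-Q) e d" "path_image d \<subseteq> ball 0 r"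
      using \<open>peripheral_at (-Q) 0 e\<close> r by (auto simp: peripheral_at_def)
    define h where "h = (\<lambda>w. a + inverse w)"
    have hI: "h (I z) = z" for z by (simp add: h_def I_def)
    have Ih: "I (h w) = w" for w by (simp add: h_def I_def)
    have "homotopic_loops (-P) (h \<circ> e) (h \<circ> d)"
    proof (rule homotopic_loops_continuous_image[OF d(1)])
      show "continuous_on (-Q) h" unfolding h_def by (intro continuous_intros) (auto simp: Q_def)
      have "w \<in> Q" if "h w \<in> P" for w using imageI[OF that, of I] by (simp add: Q_def Ih)
      then show "h \<in> - Q \<rightarrow> - P" by blast
    qed
    moreover have "h \<circ> e = c" by (auto simp: e_def hI)
    moreover have "path_image (h \<circ> d) \<subseteq> {z. R < norm z}"
    proof -
      have "R < norm (h w)" if "w \<in> path_image d" for w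
      proof -
        have "path_image d \<subseteq> - Q" using d homotopic_loops_imp_subset by blast
        then have "w \<noteq> 0" using that by (auto simp: Q_def)
        then have "1 / norm w > 1 / r" using d that r by (intro divide_strict_left_mono) auto
        moreover have "norm (inverse w) \<le> norm (h w) + norm a"
          unfolding h_def by (metis add_diff_cancel_left' norm_triangle_ineq4)
        ultimately show ?thesis using r by (simp add: inverse_eq_divide norm_divide)
      qed
      then show ?thesis by (auto simp: path_image_compose)
    qed
    ultimately show "\<exists>d. homotopic_loops (- P) c d \<and> path_image d \<subseteq> {z. R < norm z}" by metis
  qed
qed

text \<open>Infinity is a fourth puncture, always on the outer side. Unless the four split two and
  two, one side holds at most one of them.\<close>

lemma trivial_curve_Pfin:
  assumes "simple_closed_curve_in Sf c" "card (inside (path_image c) \<inter> Pfin) \<noteq> 2"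
  shows "trivial_curve Pfin c"
proof -
  let ?K = "inside (path_image c) \<inter> Pfin"
  have fin: "finite Pfin" "card Pfin \<le> 3" by (auto simp: Pfin_def card_insert_if)
  have c: "simple_closed_curve_in (- Pfin) c" using assms(1) by (simp add: Sf_def)
  have le: "card ?K \<le> card Pfin" using fin by (intro card_mono) auto
  then consider "card ?K = 0" | "card ?K = 1" | "card ?K = card Pfin" using fin(2) assms(2) by linarith
  then show ?thesis
  proof cases
    case 1
    then show ?thesis unfolding trivial_curve_def using inessential_if_inside[OF c fin(1)] fin by auto
  next
    case 2
    then obtain p where "?K = {p}" by (meson card_1_singletonE)
    then show ?thesis unfolding trivial_curve_def using peripheral_at_if_inside[OF c fin(1), of p] by blast
  next
    case 3
    then have "?K = Pfin" using fin by (intro card_subset_eq) auto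
    then show ?thesis unfolding trivial_curve_def using peripheral_at_infinity_if_inside[OF c fin(1)] by blast
  qed
qed

subsection \<open>Univalent inverse branches\<close>

text \<open>The square has norm at least \<open>3 * R\<close>, and adding \<open>\<i>\<close> costs
  at most 1. So the preimage of a disc of radius at least 3 around 0 stays in that disc, which
  bounds both pullbacks and inverse branches.\<close>

lemma norm_fmap_ge:
  assumes "R \<ge> 3" "norm z \<ge> R"
  shows "norm (fmap z) \<ge> R"
proof -
  have "norm (z ^ 2) \<le> norm (fmap z) + norm \<i>"
    unfolding fmap_def by (metis add_diff_cancel_right' norm_triangle_ineq4)
  moreover have "norm (z ^ 2) \<ge> R * R"
    using assms by (simp add: norm_mult power2_eq_square mult_mono)
  moreover have "R * R \<ge> 3 * R" using assms by simp
  ultimately show ?thesis using assms unfolding norm_ii by linarith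
qed

lemma norm_fmap_funpow_ge:
  assumes "R \<ge> 3" "norm z \<ge> R"
  shows "norm ((fmap ^^ m) z) \<ge> R"
  using assms by (induction m) (auto intro: norm_fmap_ge)

lemma has_field_derivative_fmap: "(fmap has_field_derivative 2 * z) (at z)"
  unfolding fmap_def[abs_def] by (auto intro!: derivative_eq_intros)

lemma holomorphic_fmap: "fmap holomorphic_on S"
  unfolding fmap_def[abs_def] by (intro holomorphic_intros)

lemma holomorphic_fmap_funpow: "(fmap ^^ m) holomorphic_on S"
  by (induction m) (auto simp del: o_apply simp: id_def intro: holomorphic_on_compose holomorphic_fmap)

lemma fmap_Pfin: "fmap \<i> = \<i> - 1" "fmap (\<i> - 1) = -\<i>" "fmap (-\<i>) = \<i> - 1"
  by (auto simp: fmap_def power2_eq_square algebra_simps)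

lemma Pfin_distinct: "\<i> \<noteq> \<i> - 1" "\<i> - 1 \<noteq> -\<i>" "\<i> \<noteq> -\<i>"
  by (auto simp: complex_eq_iff)

lemma fmap_funpow_cycle:
  "((fmap ^^ m) (\<i> - 1) = \<i> - 1 \<and> (fmap ^^ m) (-\<i>) = -\<i>) \<or>
   ((fmap ^^ m) (\<i> - 1) = -\<i> \<and> (fmap ^^ m) (-\<i>) = \<i> - 1)"
  by (induction m) (auto simp: fmap_Pfin)

text \<open>By the chain rule each iteration contributes a factor \<open>2 * w\<close> with
  \<open>w\<close> in the cycle, where \<open>norm w\<close> is 1 or the square root of 2. The cycle
  is repelling.\<close>

lemma deriv_fmap_funpow_cycle:
  assumes "w \<in> {\<i> - 1, -\<i>}"
  shows "norm (deriv (fmap ^^ m) w) \<ge> 2 ^ m"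
proof (induction m)
  case 0
  show ?case by (simp add: id_def)
next
  case (Suc m)
  have "((fmap ^^ m) has_field_derivative deriv (fmap ^^ m) w) (at w)"
    using holomorphic_derivI[OF holomorphic_fmap_funpow[of m UNIV]] by simp
  then have "((fmap \<circ> (fmap ^^ m)) has_field_derivative 2 * (fmap ^^ m) w * deriv (fmap ^^ m) w) (at w)"
    using has_field_derivative_fmap by (rule DERIV_chain[rotated])
  then have D: "deriv (fmap ^^ Suc m) w = 2 * (fmap ^^ m) w * deriv (fmap ^^ m) w"
    by (simp add: DERIV_imp_deriv)
  have "(fmap ^^ m) w \<in> {\<i> - 1, -\<i>}" using assms fmap_funpow_cycle[of m] by auto
  moreover have "norm (\<i> - 1) \<ge> 1" by (simp add: cmod_def)
  ultimately have "norm ((fmap ^^ m) w) \<ge> 1" by auto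
  then have "1 * 2 ^ m \<le> norm ((fmap ^^ m) w) * norm (deriv (fmap ^^ m) w)"
    using Suc by (intro mult_mono) auto
  then show ?case unfolding D by (simp add: norm_mult)
qed

text \<open>Such a \<open>V\<close> carries a holomorphic inverse of the iterate, defined on
  \<open>D\<close>. Having the cycle in \<open>V\<close> forces this branch to permute the cycle, as
  the iterate does.\<close>

definition univalent_over :: "complex set \<Rightarrow> nat \<Rightarrow> complex set \<Rightarrow> bool" where
  "univalent_over D n V \<longleftrightarrow> open V \<and> inj_on (fmap ^^ n) V \<and> (fmap ^^ n) ` V = D \<and> {\<i> - 1, -\<i>} \<subseteq> V"

lemma no_long_univalent_lift:
  assumes D: "open D" "connected D" "bounded D"
  shows "\<exists>M. \<forall>m\<ge>M. \<nexists>V. univalent_over D m V"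
proof (rule ccontr)
  define a where "a = \<i> - 1"
  define b where "b = -\<i>"
  assume "\<not> ?thesis"
  then have "\<forall>k. \<exists>m V. m \<ge> k \<and> open V \<and> inj_on (fmap ^^ m) V \<and> (fmap ^^ m) ` V = D \<and> {a, b} \<subseteq> V"
    unfolding a_def b_def univalent_over_def by metis
  then obtain m V where mV: "\<And>k. m k \<ge> k" "\<And>k. open (V k)" "\<And>k. inj_on (fmap ^^ m k) (V k)"
      "\<And>k. (fmap ^^ m k) ` V k = D" "\<And>k. {a, b} \<subseteq> V k"
    by metis
  have "\<exists>g. g holomorphic_on D \<and> (\<forall>z\<in>V k. deriv (fmap ^^ m k) z * deriv g ((fmap ^^ m k) z) = 1)
          \<and> (\<forall>z\<in>V k. g ((fmap ^^ m k) z) = z)" for k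
    using holomorphic_has_inverse[OF holomorphic_fmap_funpow mV(2,3)] mV(4) by metis
  then obtain g where g: "\<And>k. g k holomorphic_on D"
      "\<And>k z. z \<in> V k \<Longrightarrow> deriv (fmap ^^ m k) z * deriv (g k) ((fmap ^^ m k) z) = 1"
      "\<And>k z. z \<in> V k \<Longrightarrow> g k ((fmap ^^ m k) z) = z"
    by metis
  have gD: "g k z \<in> V k" "(fmap ^^ m k) (g k z) = z" if "z \<in> D" for k z
    using that mV(4)[of k] g(3)[of _ k] by (metis imageE)+
  have inj: "inj_on (g k) D" for k using gD(2) by (metis inj_onI)
  have gab: "g k a = a \<and> g k b = b \<or> g k a = b \<and> g k b = a" for k
    using fmap_funpow_cycle[of "m k"] g(3)[of a k] g(3)[of b k] mV(5)[of k] unfolding a_def b_def by auto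
  \<comment> \<open>The iterate permutes the cycle, which lies in \<open>V 0\<close>, and maps
    \<open>V 0\<close> onto \<open>D\<close>.\<close>
  have ab: "a \<in> D" "b \<in> D" "a \<noteq> b"
    using fmap_funpow_cycle[of "m 0"] mV(4)[of 0] mV(5)[of 0] Pfin_distinct unfolding a_def b_def by force+
  have dg: "norm (deriv (g k) a) \<le> (1/2) ^ k" for k
  proof -
    have "deriv (fmap ^^ m k) (g k a) * deriv (g k) a = 1"
      using g(2)[OF gD(1)[OF ab(1)]] gD(2)[OF ab(1)] by simp
    then have "norm (deriv (fmap ^^ m k) (g k a)) * norm (deriv (g k) a) = 1"
      by (metis norm_mult norm_one)
    moreover have "norm (deriv (fmap ^^ m k) (g k a)) \<ge> 2 ^ m k"
      using gab[of k] by (intro deriv_fmap_funpow_cycle) (auto simp: a_def b_def)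
    moreover have "(2::real) ^ m k \<ge> 2 ^ k" using mV(1) by simp
    ultimately have "2 ^ k * norm (deriv (g k) a) \<le> 1"
      by (metis mult_right_mono norm_ge_zero order_trans)
    then show ?thesis by (simp add: field_simps power_one_over)
  qed
  obtain R0 where R0: "D \<subseteq> ball 0 R0" using D(3) bounded_subset_ballD by blast
  \<comment> \<open>An orbit starting at norm at least \<open>R\<close> never gets below
    \<open>R\<close>, so it cannot end in \<open>D\<close>; this bounds all branches at once, as
    Montel's theorem needs.\<close>
  define R where "R = max 3 R0"
  have gR: "norm (g k z) \<le> R" if "z \<in> D" for k z
  proof (rule ccontr)
    assume "\<not> norm (g k z) \<le> R"
    then have "norm ((fmap ^^ m k) (g k z)) \<ge> R" by (intro norm_fmap_funpow_ge) (auto simp: R_def)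
    then have "norm z \<ge> R" using gD(2)[OF that] by simp
    then show False using R0 that by (auto simp: R_def)
  qed
  obtain G r where G: "G holomorphic_on D" "strict_mono (r :: nat \<Rightarrow> nat)"
     "\<And>x. x \<in> D \<Longrightarrow> (\<lambda>n. g (r n) x) \<longlonglongrightarrow> G x"
     "\<And>K. \<lbrakk>compact K; K \<subseteq> D\<rbrakk> \<Longrightarrow> uniform_limit K (g \<circ> r) G sequentially"
    using Montel[of D "{h. h holomorphic_on D \<and> (\<forall>z\<in>D. norm (h z) \<le> R)}" g] D(1) g(1) gR
    by (smt (verit) image_subset_iff mem_Collect_eq subsetD)
  \<comment> \<open>Every branch preserves the distance between the two cycle points, hence so does
    the limit. This excludes the constant case in Hurwitz's theorem.\<close>
  have "(\<lambda>n. norm (g (r n) a - g (r n) b)) \<longlonglongrightarrow> norm (G a - G b)"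
    by (intro tendsto_intros G ab)
  moreover have "norm (g (r n) a - g (r n) b) = norm (a - b)" for n
    using gab[of "r n"] by (auto simp: norm_minus_commute)
  ultimately have "norm (G a - G b) = norm (a - b)" by (simp add: LIMSEQ_const_iff)
  then have "G a \<noteq> G b" using ab by auto
  then have "\<not> G constant_on D" using ab unfolding constant_on_def by metis
  then have "inj_on G D"
    using Hurwitz_injective[of D "g \<circ> r" G] D G g inj by auto
  then have "deriv G a \<noteq> 0" using holomorphic_injective_imp_regular G D ab by blast
  moreover have "(\<lambda>n. deriv (g (r n)) a) \<longlonglongrightarrow> deriv G a"
  proof -
    obtain \<rho> where \<rho>: "\<rho> > 0" "cball a \<rho> \<subseteq> D" using D(1) ab open_contains_cball by blast
    then have "uniform_limit (ball a \<rho>) (g \<circ> r) G sequentially"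
      using G(4) uniform_limit_on_subset ball_subset_cball compact_cball by metis
    moreover have "(g \<circ> r) n holomorphic_on ball a \<rho>" for n
      unfolding comp_apply using g(1) \<rho>(2) ball_subset_cball holomorphic_on_subset by (metis subset_trans)
    ultimately show ?thesis
      using higher_deriv_complex_uniform_limit[where A = "ball a \<rho>" and f = "g \<circ> r" and g = G
          and F = sequentially and z = a and m = 1] \<rho> by auto
  qed
  moreover have "(\<lambda>n. deriv (g (r n)) a) \<longlonglongrightarrow> 0"
  proof (rule Lim_null_comparison)
    show "(\<lambda>n. (1/2) ^ n) \<longlonglongrightarrow> (0::real)" by (rule LIMSEQ_power_zero) auto
    have "norm (deriv (g (r n)) a) \<le> (1/2) ^ n" for n
      using dg[of "r n"] power_decreasing[of n "r n" "1/2::real"] seq_suble[OF G(2), of n] by linarith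
    then show "\<forall>\<^sub>F n in sequentially. norm (deriv (g (r n)) a) \<le> (1/2) ^ n" by simp
  qed
  ultimately show False using LIMSEQ_unique by blast
qed

subsection \<open>Pullbacks of simple closed curves\<close>

text \<open>\<open>Pfin\<close> is forward invariant, so pulling back never creates intersections
  with it.\<close>

lemma fmap_preimage_in_Sf:
  assumes "path_image c \<subseteq> Sf" "fmap z \<in> path_image c"
  shows "z \<in> Sf"
proof -
  have "fmap w \<in> Pfin" if w: "w \<in> Pfin" for w
  proof -
    consider "w = \<i>" | "w = \<i> - 1" | "w = -\<i>" using w unfolding Pfin_def by blast
    then show ?thesis by cases (simp_all only: fmap_Pfin Pfin_def insert_iff simp_thms)
  qed
  then show ?thesis using assms by (auto simp: Sf_def)
qed

lemma components_Un_closed: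
  assumes "closed A" "connected A" "closed B" "connected B" "A \<inter> B = {}" "C \<in> components (A \<union> B)"
  shows "C = A \<or> C = B"
proof -
  have C: "C \<subseteq> A \<union> B" "connected C" "C \<noteq> {}"
    using assms in_components_subset in_components_connected in_components_nonempty by blast+
  have "A \<inter> C = {} \<or> B \<inter> C = {}"
    using connected_closedD[OF C(2) _ C(1)] assms by auto
  moreover have "A \<subseteq> C" if "A \<inter> C \<noteq> {}" using components_maximal assms that by blast
  moreover have "B \<subseteq> C" if "B \<inter> C \<noteq> {}" using components_maximal assms that by blast
  ultimately show ?thesis using C by blast
qed

lemma fmap_eq_iff: "fmap x = fmap y \<longleftrightarrow> x = y \<or> x = -y"
  by (simp only: fmap_def add_right_cancel power2_eq_iff)

lemma continuous_on_fmap: "continuous_on S fmap"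
  by (simp add: holomorphic_fmap holomorphic_on_imp_continuous_on)

text \<open>The curve and its interior lie in a simply connected set missing the critical value
  \<open>\<i>\<close>, on which \<open>z - \<i>\<close> has a continuous square root. The two signs
  give disjoint lifts, each injective on the interior as well.\<close>

lemma pullback_noncritical:
  assumes c: "simple_closed_curve_in Sf c" and i: "\<i> \<notin> inside (path_image c)"
    and C: "C \<in> components (fmap -` path_image c)"
  obtains d where "simple_closed_curve_in Sf d" "path_image d = C"
    "inj_on fmap (inside (path_image d))" "fmap ` inside (path_image d) = inside (path_image c)"
proof -
  have c': "simple_path c" "pathfinish c = pathstart c" "path_image c \<subseteq> Sf"
    using c by (auto simp: simple_closed_curve_in_def)
  note J = Jordan_inside_outside[OF c'(1,2)]
  have "\<i> \<notin> path_image c" using c' by (auto simp: Sf_def Pfin_def)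
  then have "{\<i>} \<subseteq> outside (path_image c)" using i by (auto simp: outside_inside)
  then obtain U where U: "open U" "bounded U" "simply_connected U" "path_image c \<subseteq> U" "U \<inter> {\<i>} = {}"
    using simply_connected_neighbourhood[OF c'(1,2), of "{\<i>}"] by blast
  have inU: "inside (path_image c) \<subseteq> U" using subset_simply_connected_imp_inside_subset U by blast
  have "continuous_on U (\<lambda>z. z - \<i>)" "\<forall>z\<in>U. z - \<i> \<noteq> 0" using U by (auto intro!: continuous_intros)
  then obtain s where s: "continuous_on U s" "\<And>z. z \<in> U \<Longrightarrow> z - \<i> = (s z)\<^sup>2"
    using simply_connected_eq_continuous_sqrt[OF U(1)] U(3) by blast
  have fs: "fmap (s z) = z" "fmap (- s z) = z" "s z \<noteq> 0" if "z \<in> U" for z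
    using s(2)[OF that] that U(5) by (auto simp: fmap_def algebra_simps)
  have pre: "fmap w \<in> path_image c \<Longrightarrow> w = s (fmap w) \<or> w = - s (fmap w)" for w
    using fs(1)[of "fmap w"] U(4) fmap_eq_iff[of w "s (fmap w)"] by (metis subsetD)
  have X: "fmap -` path_image c = s ` path_image c \<union> (\<lambda>z. - s z) ` path_image c" (is "_ = ?A \<union> ?B")
  proof
    show "fmap -` path_image c \<subseteq> ?A \<union> ?B" using pre by blast
    show "?A \<union> ?B \<subseteq> fmap -` path_image c" using fs(1,2) U(4) by auto
  qed
  have contA: "continuous_on (path_image c) s" "continuous_on (path_image c) (\<lambda>z. - s z)"
    using s U(4) by (auto intro!: continuous_intros intro: continuous_on_subset)
  have "closed ?A" "closed ?B" "connected ?A" "connected ?B"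
    using contA c' by (auto intro!: compact_imp_closed compact_continuous_image connected_continuous_image
       simp: compact_simple_path_image connected_simple_path_image)
  \<comment> \<open>Applying \<open>fmap\<close> to a common point gives \<open>x = y\<close>, so
    \<open>s y = - s y\<close>; but \<open>s\<close> does not vanish on \<open>U\<close>.\<close>
  moreover have "?A \<inter> ?B = {}"
  proof -
    have "s x \<noteq> - s y" if "x \<in> path_image c" "y \<in> path_image c" for x y
    proof
      assume eq: "s x = - s y"
      have xy: "x \<in> U" "y \<in> U" using that U(4) by auto
      have "fmap (- s y) = x" using fs(1)[OF xy(1)] unfolding eq .
      then have "x = y" using fs(2)[OF xy(2)] by (rule trans[OF sym])
      then show False using eq fs(3)[OF xy(2)] by simp
    qed
    then show ?thesis by auto
  qed
  ultimately have "C = ?A \<or> C = ?B" using components_Un_closed C unfolding X by simp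
  then obtain t where t: "C = t ` path_image c" "continuous_on U t" "\<And>z. z \<in> U \<Longrightarrow> fmap (t z) = z"
  proof
    assume "C = ?A"
    then show thesis using s(1) fs(1) by (rule that)
  next
    assume "C = ?B"
    then show thesis using continuous_on_minus[OF s(1)] fs(2) by (rule that)
  qed
  have injt: "inj_on t U" using t(3) by (metis inj_onI)
  define d where "d = t \<circ> c"
  have im: "path_image d = t ` path_image c" by (simp add: d_def path_image_compose)
  have d: "simple_path d" "pathfinish d = pathstart d"
    unfolding d_def using c' continuous_on_subset[OF t(2) U(4)] inj_on_subset[OF injt U(4)]
    by (auto intro!: simple_path_continuous_image simp: pathfinish_compose pathstart_compose)
  let ?I = "inside (path_image c)"
  have clI: "closure ?I = ?I \<union> path_image c"
    using J closure_Un_frontier by metis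
  have comp: "compact (closure ?I)" using J by auto
  have "closed (t ` closure ?I)"
    using comp clI t(2) inU U(4)
    by (intro compact_imp_closed compact_continuous_image) (auto intro: continuous_on_subset)
  \<comment> \<open>The lifted closure is compact, hence closed, so the lifted interior can only
    have boundary points on the lifted curve.\<close>
  then have clt: "closure (t ` ?I) \<subseteq> t ` closure ?I" by (intro closure_minimal image_mono closure_subset)
  have opn: "open (t ` ?I)"
    using J continuous_on_subset[OF t(2) inU] inj_on_subset[OF injt inU] by (intro invariance_of_domain) auto
  have inside_d: "inside (path_image d) = t ` ?I"
  proof (rule inside_eqI)
    show "connected (inside (path_image d))" using Jordan_inside_outside[OF d] by blast
    have "compact (t ` closure ?I)"
      using comp clI t(2) inU U(4) by (intro compact_continuous_image) (auto intro: continuous_on_subset)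
    then show "bounded (t ` ?I)" by (meson bounded_subset closure_subset compact_imp_bounded image_mono)
    show "t ` ?I \<noteq> {}" using J by blast
    show "t ` ?I \<inter> path_image d = {}" unfolding im
      using inj_on_image_Int[OF injt inU U(4)] by simp
    show "frontier (t ` ?I) \<subseteq> path_image d"
      using clt unfolding clI im frontier_def interior_open[OF opn] by blast
  qed
  have "path_image d \<subseteq> Sf"
    unfolding im using t U(4) c' by (auto intro!: fmap_preimage_in_Sf[OF c'(3)] simp: subset_iff)
  then have "simple_closed_curve_in Sf d" using d by (simp add: simple_closed_curve_in_def)
  moreover have "path_image d = C" by (simp add: im t(1))
  moreover have "inj_on fmap (inside (path_image d))" "fmap ` inside (path_image d) = ?I"
    unfolding inside_d using t(3) inU by (auto simp: inj_on_def image_image subset_iff)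
  ultimately show thesis by (rule that)
qed

text \<open>The curve winds once around the critical value, so a square root \<open>r\<close> of its translate by \<open>-\<i>\<close>
  changes sign after one turn; \<open>r\<close> followed by \<open>-r\<close> is the preimage.\<close>
lemma pullback_critical:
  assumes c: "simple_closed_curve_in Sf c" and i: "\<i> \<in> inside (path_image c)"
    and C: "C \<in> components (fmap -` path_image c)"
  obtains d where "simple_closed_curve_in Sf d" "path_image d = C"
    "inside (path_image d) = fmap -` inside (path_image c)"
proof -
  have c': "simple_path c" "pathfinish c = pathstart c" "path_image c \<subseteq> Sf"
    using c by (auto simp: simple_closed_curve_in_def)
  note J = Jordan_inside_outside[OF c'(1,2)]
  let ?I = "inside (path_image c)"
  have ni: "\<i> \<notin> path_image c" using i inside_no_overlap by blast
  obtain q where q: "path q" "pathfinish q - pathstart q = 2 * of_real pi * \<i> * winding_number c \<i>"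
       "\<And>t. t \<in> {0..1} \<Longrightarrow> c t = \<i> + exp (q t)"
    using winding_number_as_continuous_log[of c \<i>] ni c' simple_path_imp_path by blast
  have wn: "winding_number c \<i> = 1 \<or> winding_number c \<i> = -1"
    using simple_closed_path_winding_number_inside[OF c'(1)] i by metis
  define r where "r = (\<lambda>t. exp (q t / 2))"
  have rc: "fmap (r t) = c t" "fmap (- r t) = c t" if "t \<in> {0..1}" for t
    using q(3)[OF that] by (auto simp: fmap_def r_def exp_double[symmetric])
  have r0: "r t \<noteq> 0" for t by (simp add: r_def)
  have r1: "r 1 = - r 0"
  proof -
    have "q 1 / 2 = q 0 / 2 + of_real pi * \<i> * winding_number c \<i>"
      using q(2) by (simp add: path_defs field_simps)
    then have "r 1 = r 0 * exp (of_real pi * \<i> * winding_number c \<i>)"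
      unfolding r_def by (metis exp_add)
    also have "exp (of_real pi * \<i> * winding_number c \<i>) = -1"
      using wn by (auto simp: exp_minus)
    finally show ?thesis by simp
  qed
  have lf: "x = y \<or> x = 0 \<and> y = 1 \<or> x = 1 \<and> y = 0" if "c x = c y" "x \<in> {0..1}" "y \<in> {0..1}" for x y
    using c'(1) that by (auto simp: simple_path_def loop_free_def)
  have pr: "path r" using q(1) unfolding r_def path_def by (intro continuous_intros) auto
  \<comment> \<open>A coincidence of \<open>r\<close> projects to one of \<open>c\<close>, which can
    only be the closing of the loop, and there \<open>r\<close> has changed sign.\<close>
  have injr: "inj_on r {0..1}"
  proof (rule inj_onI)
    fix x y :: real assume *: "x \<in> {0..1}" "y \<in> {0..1}" "r x = r y"
    then have "c x = c y" using rc by metis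
    then show "x = y" using lf[of x y] * r1 r0[of 0] by auto
  qed
  define r' where "r' = (\<lambda>t. - r t)"
  have arcs: "arc r" "arc r'"
    using pr injr unfolding arc_def r'_def path_def inj_on_def by (auto intro!: continuous_intros)
  define d where "d = r +++ r'"
  have ends: "pathstart r = r 0" "pathfinish r = - r 0" "pathstart r' = - r 0" "pathfinish r' = r 0"
    using r1 by (auto simp: path_defs r'_def)
  have "simple_path d" unfolding d_def
  proof (rule simple_path_join_loop)
    show "path_image r \<inter> path_image r' \<subseteq> {pathstart r, pathstart r'}"
    proof
      fix w assume "w \<in> path_image r \<inter> path_image r'"
      then obtain x y where xy: "x \<in> {0..1}" "y \<in> {0..1}" "w = r x" "w = - r y"
        by (auto simp: path_image_def r'_def)
      then have "c x = c y" using rc by metis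
      moreover have "x \<noteq> y" using xy r0[of y] by auto
      ultimately have "x = 0 \<or> x = 1" using lf xy by blast
      then show "w \<in> {pathstart r, pathstart r'}" using xy ends r1 by auto
    qed
  qed (use arcs ends in auto)
  then have d: "simple_path d" "pathfinish d = pathstart d" by (auto simp: d_def ends)
  have im: "path_image d = fmap -` path_image c"
  proof -
    have "path_image d = path_image r \<union> path_image r'"
      unfolding d_def by (rule path_image_join) (simp add: ends)
    also have "\<dots> = fmap -` path_image c"
    proof
      show "path_image r \<union> path_image r' \<subseteq> fmap -` path_image c"
        using rc by (auto simp: path_image_def r'_def)
      show "fmap -` path_image c \<subseteq> path_image r \<union> path_image r'"
      proof
        fix w assume "w \<in> fmap -` path_image c"
        then obtain t where "t \<in> {0..1}" "fmap w = fmap (r t)" using rc by (auto simp: path_image_def)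
        then show "w \<in> path_image r \<union> path_image r'" by (auto simp: fmap_eq_iff path_image_def r'_def)
      qed
    qed
    finally show ?thesis .
  qed
  \<comment> \<open>The full preimage is a single closed curve, so it is its own only
    component.\<close>
  have "C = path_image d"
    using C connected_simple_path_image[OF d(1)] d(1) unfolding im[symmetric]
    by (metis components_eq_sing_iff path_image_nonempty singletonD)
  have contv: "closed (fmap -` T)" if "closed T" for T
    using closed_vimage[OF that continuous_on_fmap] .
  have opn: "open (fmap -` ?I)"
    using open_vimage[OF _ continuous_on_fmap] J by blast
  have clI: "closure ?I = ?I \<union> path_image c"
    using J closure_Un_frontier by metis
  have "inside (path_image d) = fmap -` ?I"
  proof (rule inside_eqI)
    show "connected (inside (path_image d))" using Jordan_inside_outside[OF d] by blast
    have "bounded ?I" using J by blast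
    then obtain R where R: "?I \<subseteq> ball 0 R" using bounded_subset_ballD[of ?I 0] by blast
    have "fmap -` ?I \<subseteq> ball 0 (max 3 R)"
    proof
      fix w assume "w \<in> fmap -` ?I"
      then have "fmap w \<in> ball 0 R" using R by blast
      then have "norm (fmap w) < max 3 R" by simp
      then have "norm w < max 3 R" using norm_fmap_ge[of "max 3 R" w] by (meson max.cobounded1 not_le)
      then show "w \<in> ball 0 (max 3 R)" by auto
    qed
    then show "bounded (fmap -` ?I)" using bounded_ball bounded_subset by blast
    have "fmap 0 = \<i>" by (simp add: fmap_def)
    then show "fmap -` ?I \<noteq> {}" using i by (metis empty_iff vimage_eq)
    show "fmap -` ?I \<inter> path_image d = {}"
      unfolding im vimage_Int[symmetric] inside_no_overlap by simp
    have "closure (fmap -` ?I) \<subseteq> fmap -` closure ?I"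
      by (rule closure_minimal[OF vimage_mono[OF closure_subset] contv[OF closed_closure]])
    then show "frontier (fmap -` ?I) \<subseteq> path_image d"
      unfolding clI im frontier_def interior_open[OF opn] by blast
  qed
  moreover have "path_image d \<subseteq> Sf"
    unfolding im using fmap_preimage_in_Sf[OF c'(3)] by blast
  then have "simple_closed_curve_in Sf d" using d by (simp add: simple_closed_curve_in_def)
  ultimately show thesis using that[OF _ \<open>C = path_image d\<close>[symmetric]] by blast
qed

section \<open>Components of iterated preimages\<close>

text \<open>The image of \<open>C\<close> is connected, hence inside some component
  \<open>C'\<close>. The preimage of \<open>C'\<close> lies between \<open>C\<close> and the full
  iterated preimage, so \<open>C\<close> is still a component of it.\<close>

lemma components_funpow_Suc:
  assumes C: "C \<in> components {z. (f ^^ Suc n) z \<in> S}" and cont: "continuous_on UNIV f"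
  obtains C' where "C' \<in> components {z. (f ^^ n) z \<in> S}" "C \<in> components (f -` C')"
proof -
  let ?X = "\<lambda>n. {z. (f ^^ n) z \<in> S}"
  have Csub: "C \<subseteq> ?X (Suc n)" "connected C" "C \<noteq> {}"
    using C in_components_subset in_components_connected in_components_nonempty by blast+
  then have "connected (f ` C)" using cont connected_continuous_image continuous_on_subset by blast
  moreover have fC: "f ` C \<subseteq> ?X n" using Csub(1) by (auto simp: funpow_swap1)
  ultimately obtain C' where C': "C' \<in> components (?X n)" "f ` C \<subseteq> C'"
    using Csub(3) by (metis exists_component_superset image_is_empty subset_empty)
  have "f -` C' \<subseteq> ?X (Suc n)" using in_components_subset[OF C'(1)] by (auto simp: funpow_swap1)
  then have "C \<in> components (f -` C')"
    using C'(2) by (intro components_intermediate_subset[OF C]) auto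
  with C'(1) show thesis by (rule that)
qed

lemma univalent_over_Suc:
  assumes "univalent_over D n V" "open W" "inj_on fmap W" "fmap ` W = V" "{\<i> - 1, -\<i>} \<subseteq> W"
  shows "univalent_over D (Suc n) W"
proof -
  have "(fmap ^^ Suc n) = (fmap ^^ n) \<circ> fmap" by (simp only: funpow_Suc_right)
  then show ?thesis
    using assms
      by (auto simp del: funpow.simps simp: univalent_over_def comp_inj_on image_comp[symmetric])
qed

lemma card_Int_three_eq_2:
  assumes "x \<noteq> y" "y \<noteq> z" "x \<noteq> z"
  shows "card (X \<inter> {x, y, z}) = 2 \<longleftrightarrow>
    x \<in> X \<and> y \<in> X \<and> z \<notin> X \<or> x \<in> X \<and> y \<notin> X \<and> z \<in> X \<or> x \<notin> X \<and> y \<in> X \<and> z \<in> X"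
  using assms by (auto simp: Int_insert_right card_insert_if)

lemmas card_Int_Pfin = card_Int_three_eq_2[OF Pfin_distinct, folded Pfin_def]
text \<open>The invariant sorts nontrivial curves by the enclosed pair. As a pullback,
  \<open>{\<i> - 1, -\<i>}\<close> arises only from itself, \<open>{\<i>, \<i> - 1}\<close> only
  from that pair, and \<open>{\<i>, -\<i>}\<close> only from \<open>{\<i>, \<i> - 1}\<close>; hence
  the delays 0, 1 and 2 in the univalent lift. The exceptions \<open>n = 0\<close> and
  \<open>n \<le> 1\<close> allow the initial curve to be of any kind.\<close>

lemma components_of_preimage:
  assumes "simple_closed_curve_in Sf \<gamma>" "C \<in> components {z. (fmap ^^ n) z \<in> path_image \<gamma>}"
  defines "D \<equiv> inside (path_image \<gamma>)"
  shows "\<exists>c X. simple_closed_curve_in Sf c \<and> path_image c = C \<and> X = inside (path_image c) \<and>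
    (card (X \<inter> Pfin) = 2 \<longrightarrow>
      (\<i> \<in> X \<and> -\<i> \<notin> X \<longrightarrow> n = 0 \<or> (\<exists>V. univalent_over D (n - 1) V)) \<and>
      (\<i> \<in> X \<and> -\<i> \<in> X \<longrightarrow> n \<le> 1 \<or> (\<exists>V. univalent_over D (n - 2) V)) \<and>
      (\<i> \<notin> X \<longrightarrow> univalent_over D n X))"
  using assms(2)
proof (induction n arbitrary: C)
  case 0
  have \<gamma>: "simple_path \<gamma>" "pathfinish \<gamma> = pathstart \<gamma>"
    using assms by (auto simp: simple_closed_curve_in_def)
  have "C = path_image \<gamma>"
    using 0 connected_simple_path_image[OF \<gamma>(1)] by (simp add: components_eq_sing_iff[THEN iffD2])
  moreover have "card (D \<inter> Pfin) = 2 \<Longrightarrow> \<i> \<notin> D \<Longrightarrow> univalent_over D 0 D"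
    using Jordan_inside_outside[OF \<gamma>] unfolding card_Int_Pfin by (auto simp: univalent_over_def D_def)
  ultimately show ?case using assms by (intro exI[of _ \<gamma>] exI[of _ D]) auto
next
  case (Suc n)
  obtain C' where C': "C' \<in> components {z. (fmap ^^ n) z \<in> path_image \<gamma>}" "C \<in> components (fmap -` C')"
    using components_funpow_Suc[OF Suc.prems continuous_on_fmap] .
  from Suc.IH[OF C'(1)] obtain c X where c: "simple_closed_curve_in Sf c" "path_image c = C'"
    "X = inside (path_image c)" and IH: "card (X \<inter> Pfin) = 2 \<Longrightarrow>
      (\<i> \<in> X \<and> -\<i> \<notin> X \<longrightarrow> n = 0 \<or> (\<exists>V. univalent_over D (n - 1) V)) \<and>
      (\<i> \<in> X \<and> -\<i> \<in> X \<longrightarrow> n \<le> 1 \<or> (\<exists>V. univalent_over D (n - 2) V)) \<and>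
      (\<i> \<notin> X \<longrightarrow> univalent_over D n X)"
    by blast
  show ?case
  proof (cases "\<i> \<in> X")
    case True
    then obtain d where d: "simple_closed_curve_in Sf d" "path_image d = C"
      "inside (path_image d) = fmap -` X"
      using pullback_critical[of c C] c C' by auto
    have "\<i> \<in> fmap -` X \<longleftrightarrow> \<i> - 1 \<in> X" "\<i> - 1 \<in> fmap -` X \<longleftrightarrow> -\<i> \<in> X" "-\<i> \<in> fmap -` X \<longleftrightarrow> \<i> - 1 \<in> X"
      by (simp_all add: fmap_Pfin)
    note mem = this
    have "card (X \<inter> Pfin) = 2 \<and> -\<i> \<notin> X \<and> \<i> \<in> fmap -` X \<and> -\<i> \<in> fmap -` X" if "card (fmap -` X \<inter> Pfin) = 2"
      using that True unfolding card_Int_Pfin mem by blast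
    then show ?thesis using d IH True by (intro exI[of _ d] exI[of _ "fmap -` X"]) (auto simp: diff_Suc split: nat.splits)
  next
    case False
    then obtain d where d: "simple_closed_curve_in Sf d" "path_image d = C"
      "inj_on fmap (inside (path_image d))" "fmap ` inside (path_image d) = X"
      using pullback_noncritical[of c C] c C' by auto
    define Y where "Y = inside (path_image d)"
    have fY: "z \<in> Y \<Longrightarrow> fmap z \<in> X" for z using d by (auto simp: Y_def)
    \<comment> \<open>Injectivity allows only one of \<open>\<i>\<close>, \<open>-\<i>\<close> in
      \<open>Y\<close>. If \<open>Y\<close> holds two points, the other is \<open>\<i> - 1\<close>,
      and their images put the whole cycle into \<open>X\<close>.\<close>
    have "\<not> (\<i> \<in> Y \<and> -\<i> \<in> Y)" using inj_onD[OF d(3), of \<i> "-\<i>"] Pfin_distinct fmap_Pfin by (auto simp: Y_def)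
    moreover have "-\<i> \<in> X \<and> \<i> - 1 \<in> X" if "card (Y \<inter> Pfin) = 2"
      using that fY[of "\<i>"] fY[of "-\<i>"] fY[of "\<i> - 1"] calculation unfolding card_Int_Pfin fmap_Pfin by blast
    ultimately have Y: "univalent_over D n X \<and> \<not> (\<i> \<in> Y \<and> -\<i> \<in> Y) \<and> (\<i> \<in> Y \<or> {\<i> - 1, - \<i>} \<subseteq> Y)" if "card (Y \<inter> Pfin) = 2"
      using that IH False unfolding card_Int_Pfin by blast
    have "open Y" using d(1) Jordan_inside_outside[of d] by (auto simp: Y_def simple_closed_curve_in_def)
    then have "univalent_over D n X \<Longrightarrow> {\<i> - 1, - \<i>} \<subseteq> Y \<Longrightarrow> univalent_over D (Suc n) Y"
      using univalent_over_Suc d(3,4) Y_def by blast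
    then show ?thesis using d(1,2) Y Y_def by (intro exI[of _ d] exI[of _ Y]) auto
  qed
qed

theorem theorem4:
  fixes \<gamma> :: "real \<Rightarrow> complex"
  assumes "simple_closed_curve_in Sf \<gamma>"
    and "\<not> trivial_curve Pfin \<gamma>"
  shows "\<exists>n\<ge>1. \<forall>C \<in> components {z. (fmap ^^ n) z \<in> path_image \<gamma>}.
           \<exists>c. simple_closed_curve_in Sf c \<and> path_image c = C \<and> trivial_curve Pfin c"
proof -
  let ?D = "inside (path_image \<gamma>)"
  have "open ?D" "connected ?D" "bounded ?D"
    using assms(1) Jordan_inside_outside[of \<gamma>] by (auto simp: simple_closed_curve_in_def)
  then obtain M where M: "\<And>m V. m \<ge> M \<Longrightarrow> \<not> univalent_over ?D m V"
    using no_long_univalent_lift[of ?D] by blast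
  \<comment> \<open>With \<open>n = M + 2\<close> the levels \<open>n\<close>, \<open>n - 1\<close>
    and \<open>n - 2\<close> are all at least \<open>M\<close>, and the exceptions for
    \<open>n \<le> 1\<close> do not occur.\<close>
  have "\<exists>c. simple_closed_curve_in Sf c \<and> path_image c = C \<and> trivial_curve Pfin c"
    if C: "C \<in> components {z. (fmap ^^ (M + 2)) z \<in> path_image \<gamma>}" for C
  proof -
    obtain c X where c: "simple_closed_curve_in Sf c" "path_image c = C" "X = inside (path_image c)"
      and X: "card (X \<inter> Pfin) = 2 \<longrightarrow>
        (\<i> \<in> X \<and> -\<i> \<notin> X \<longrightarrow> M + 2 = 0 \<or> (\<exists>V. univalent_over ?D (M + 2 - 1) V)) \<and>
        (\<i> \<in> X \<and> -\<i> \<in> X \<longrightarrow> M + 2 \<le> 1 \<or> (\<exists>V. univalent_over ?D (M + 2 - 2) V)) \<and>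
        (\<i> \<notin> X \<longrightarrow> univalent_over ?D (M + 2) X)"
      using components_of_preimage[OF assms(1) C] by blast
    have "\<not> univalent_over ?D (M + 2 - 1) V" "\<not> univalent_over ?D (M + 2 - 2) V" "\<not> univalent_over ?D (M + 2) V" for V
      using M by simp_all
    then have "card (X \<inter> Pfin) \<noteq> 2" using X by auto
    then have "trivial_curve Pfin c" using trivial_curve_Pfin c by blast
    then show ?thesis using c by blast
  qed
  then show ?thesis by (intro exI[of _ "M + 2"]) auto
qed

end
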